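(* Every $\tau_{\mathcal{H}}$-continuous function $f:\mathbb{R}\to\mathbb{R}$ is $\tau_{\mathbb{Q}}$-continuous.
   Context: A function $H:\mathbb{R}\to\mathbb{R}$ is additive if $H(x+y)=H(x)+H(y)$ for all $x,y$. $\tau_{\mathcal{H}}$ is the initial topology on $\mathbb{R}$ generated by all additive functions, i.e. the smallest topology making every additive $H$ continuous as a map from $(\mathbb{R},\tau_{\mathcal{H}})$ to $\mathbb{R}$ with the usual topology. The topology $\tau_{\mathbb{Q}}$ on $\mathbb{R}$: a set $U\subseteq\mathbb{R}$ is $\tau_{\mathbb{Q}}$-open iff for every $a\in U$ and every real $x\neq0$ there is $\varepsilon(a,x)>0$ such that $a+qx\in U$ for all $q\in\mathbb{Q}$ with $0<q<\varepsilon(a,x)$. For $\tau\in\{\tau_{\mathcal{H}},\tau_{\mathbb{Q}}\}$, a function $f:\mathbb{R}\to\mathbb{R}$ is $\tau$-continuous if it is continuous from $(\mathbb{R},\tau)$ to $\mathbb{R}$ with the usual topology. *)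

theory Defs
  imports "HOL-Analysis.Analysis"
begin

(* Plain "additive" would denote Measure_Space.additive, a property of set functions. *)

definition tau_H :: "real topology" where
  "tau_H = topology_generated_by {H -` V | H V. Modules.additive (H :: real \<Rightarrow> real) \<and> open V}"

lemma openin_tau_H_vimage:
  fixes H :: "real \<Rightarrow> real"
  assumes "Modules.additive H" "open V"
  shows "openin tau_H (H -` V)"
  unfolding tau_H_def
  by (rule topology_generated_by_Basis, rule CollectI, rule exI[of _ H], rule exI[of _ V])
     (simp add: assms)

lemma topspace_tau_H [simp]: "topspace tau_H = UNIV"
proof -
  have "Modules.additive (\<lambda>x::real. x)"
    by (simp add: Modules.additive_def)
  from openin_tau_H_vimage[OF this open_UNIV] have "openin tau_H UNIV"
    by simp
  then show ?thesis
    using openin_subset by blast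
qed

lemma continuous_map_tau_H_additive:
  fixes H :: "real \<Rightarrow> real"
  assumes "Modules.additive H"
  shows "continuous_map tau_H euclidean H"
  using openin_tau_H_vimage[OF assms] by (simp add: continuous_map_def vimage_def)

lemma tau_H_coarsest:
  assumes "topspace T = UNIV"
    and "\<And>H :: real \<Rightarrow> real. Modules.additive H \<Longrightarrow> continuous_map T euclidean H"
    and "openin tau_H U"
  shows "openin T U"
proof (rule generate_topology_on_coarsest[where T = "openin T"])
  show "generate_topology_on {H -` V | H V. Modules.additive (H :: real \<Rightarrow> real) \<and> open V} U"
    using assms(3) by (simp add: tau_H_def openin_topology_generated_by_iff)
next
  fix S assume "S \<in> {H -` V | H V. Modules.additive (H :: real \<Rightarrow> real) \<and> open V}"
  then obtain H :: "real \<Rightarrow> real" and V where S: "S = H -` V" and H: "Modules.additive H" and V: "open V"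
    by blast
  show "openin T S"
    using assms(2)[OF H] V unfolding S by (simp add: continuous_map_def vimage_def assms(1))
qed simp

definition tau_Q_open :: "real set \<Rightarrow> bool" where
  "tau_Q_open U \<longleftrightarrow>
     (\<forall>a\<in>U. \<forall>x. x \<noteq> 0 \<longrightarrow> (\<exists>\<epsilon>>0. \<forall>q\<in>\<rat>. 0 < q \<and> q < \<epsilon> \<longrightarrow> a + q * x \<in> U))"

lemma istopology_tau_Q_open: "istopology tau_Q_open"
  unfolding istopology_def
proof (intro conjI allI impI)
  fix S T assume S: "tau_Q_open S" and T: "tau_Q_open T"
  show "tau_Q_open (S \<inter> T)"
    unfolding tau_Q_open_def
  proof (intro ballI allI impI)
    fix a x :: real assume a: "a \<in> S \<inter> T" and x: "x \<noteq> 0"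
    obtain e where e: "e > 0" "\<forall>q\<in>\<rat>. 0 < q \<and> q < e \<longrightarrow> a + q * x \<in> S"
      using bspec[OF S[unfolded tau_Q_open_def], of a] a x by auto
    obtain d where d: "d > 0" "\<forall>q\<in>\<rat>. 0 < q \<and> q < d \<longrightarrow> a + q * x \<in> T"
      using bspec[OF T[unfolded tau_Q_open_def], of a] a x by auto
    show "\<exists>\<epsilon>>0. \<forall>q\<in>\<rat>. 0 < q \<and> q < \<epsilon> \<longrightarrow> a + q * x \<in> S \<inter> T"
      using e d by (intro exI[of _ "min e d"]) auto
  qed
next
  fix K assume K: "\<forall>S\<in>K. tau_Q_open S"
  show "tau_Q_open (\<Union>K)"
    unfolding tau_Q_open_def
  proof (intro ballI allI impI)
    fix a x :: real assume "a \<in> \<Union>K" and x: "x \<noteq> 0"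
    then obtain S where S: "S \<in> K" "a \<in> S" by blast
    from S(1) K have oS: "tau_Q_open S" by blast
    obtain e where e: "e > 0" "\<forall>q\<in>\<rat>. 0 < q \<and> q < e \<longrightarrow> a + q * x \<in> S"
      using bspec[OF oS[unfolded tau_Q_open_def], of a] S(2) x by auto
    show "\<exists>\<epsilon>>0. \<forall>q\<in>\<rat>. 0 < q \<and> q < \<epsilon> \<longrightarrow> a + q * x \<in> \<Union>K"
      using e S(1) by (intro exI[of _ e]) auto
  qed
qed

definition tau_Q :: "real topology" where
  "tau_Q = topology tau_Q_open"

lemma openin_tau_Q: "openin tau_Q U \<longleftrightarrow> tau_Q_open U"
  by (simp add: tau_Q_def istopology_tau_Q_open)

lemma topspace_tau_Q [simp]: "topspace tau_Q = UNIV"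
proof -
  have "openin tau_Q UNIV"
    unfolding openin_tau_Q tau_Q_open_def
    by (intro ballI allI impI exI[of _ 1] conjI) simp_all
  then show ?thesis
    using openin_subset by blast
qed

end

theory Submission
  imports Defs
begin

text \<open>Only the inclusion of \<open>tau_H\<close> in \<open>tau_Q\<close> has to be established, since continuity is
  inherited by every finer topology on the domain. By minimality of the initial topology, the
  inclusion reduces to showing that a single additive function \<open>H\<close> is continuous for \<open>tau_Q\<close>.
  An additive function may be very irregular on the line, but it is linear over the rationals, so
  \<open>H (a + q * x) = H a + q * H x\<close> for rational \<open>q\<close>: along each rational ray, the only directions
  that \<open>tau_Q\<close> tests, \<open>H\<close> is the restriction of an affine function of \<open>q\<close>.\<close>

lemma additive_of_nat_mult:
  fixes H :: "real \<Rightarrow> real"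
  assumes "Modules.additive H"
  shows "H (of_nat n * x) = of_nat n * H x"
  by (induction n) (simp_all add: additive.zero[OF assms] additive.add[OF assms] distrib_right)

lemma additive_of_int_mult:
  fixes H :: "real \<Rightarrow> real"
  assumes "Modules.additive H"
  shows "H (of_int k * x) = of_int k * H x"
  by (cases k rule: int_cases2)
    (simp_all add: additive_of_nat_mult[OF assms] additive.minus[OF assms])

lemma additive_Rats_mult:
  fixes H :: "real \<Rightarrow> real"
  assumes "Modules.additive H" "q \<in> \<rat>"
  shows "H (q * x) = q * H x"
proof -
  obtain m n where n: "n > 0" and q: "q = of_int m / of_int n"
    using assms(2) by (rule Rats_cases')
  have "of_int n * H (q * x) = H (of_int n * (q * x))"
    by (simp add: additive_of_int_mult[OF assms(1)])
  also have "\<dots> = H (of_int m * x)"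
    using n by (simp add: q)
  also have "\<dots> = of_int m * H x"
    by (rule additive_of_int_mult[OF assms(1)])
  finally show ?thesis
    using n by (simp add: q field_simps)
qed

lemma continuous_map_tau_Q_additive:
  fixes H :: "real \<Rightarrow> real"
  assumes "Modules.additive H"
  shows "continuous_map tau_Q euclidean H"
proof -
  have "tau_Q_open (H -` V)" if V: "open V" for V
    unfolding tau_Q_open_def
  proof (intro ballI allI impI)
    fix a x :: real
    assume a: "a \<in> H -` V"
    have "open ((\<lambda>t. H a + t * H x) -` V)"
      by (intro open_vimage V continuous_intros)
    moreover have "0 \<in> (\<lambda>t. H a + t * H x) -` V"
      using a by simp
    ultimately obtain \<epsilon> where \<epsilon>: "\<epsilon> > 0" "ball 0 \<epsilon> \<subseteq> (\<lambda>t. H a + t * H x) -` V"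
      by (meson open_contains_ball)
    have "a + q * x \<in> H -` V" if q: "q \<in> \<rat>" "0 < q \<and> q < \<epsilon>" for q
    proof -
      have "q \<in> ball 0 \<epsilon>"
        using q(2) by simp
      then have "H a + q * H x \<in> V"
        using \<epsilon>(2) by blast
      then show ?thesis
        by (simp add: additive.add[OF assms] additive_Rats_mult[OF assms q(1)])
    qed
    then show "\<exists>\<epsilon>>0. \<forall>q\<in>\<rat>. 0 < q \<and> q < \<epsilon> \<longrightarrow> a + q * x \<in> H -` V"
      using \<epsilon>(1) by blast
  qed
  then show ?thesis
    by (simp add: continuous_map_def openin_tau_Q vimage_def)
qed

theorem theorem4p2:
  fixes f :: "real \<Rightarrow> real"
  assumes "continuous_map tau_H euclidean f"
  shows "continuous_map tau_Q euclidean f"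
proof -
  have "openin tau_Q U" if "openin tau_H U" for U
    using tau_H_coarsest[OF topspace_tau_Q continuous_map_tau_Q_additive that] .
  then show ?thesis
    using assms by (simp add: continuous_map_def)
qed

end
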